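(* Suppose that $A$ is the generator of a bounded sine family $(S(t))_{t>0}$ on a Banach space $X$ such that $(\lambda-A)^{-1}$ is a compact operator for some $\lambda$ large enough. Let $h:\mathbb{N}_0\to(0,\infty)$ be an admissible weight and let $f:\mathbb{N}_0\times X\to X$ satisfy the following conditions: (i) There exist $M\in l^\infty(\mathbb{N}_0)$ and a function $W:[0,\infty)\to[0,\infty)$, with $W(y)\le Cy$ for all $y\in[0,\infty)$ (for some constant $C$), such that $\|f(k,x)\|\le M(k)W(\|x\|)$ for all $k\in\mathbb{N}_0$ and $x\in X$. (ii) The Nemytskii operator $\mathcal{N}_f$ is continuous in $l_h^\infty(\mathbb{N}_0;X)$. Then, for each $1<\alpha\le 2$, the problem $$\Delta^{\alpha}u(n)=Au(n+2)+f(n,u(n)),\quad n\in\mathbb{N}_0,\qquad u(0)=0,\quad u(1)=0,$$ has a unique solution in $l_h^\infty(\mathbb{N}_0;X)$.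
   Context: $\mathbb{N}_0=\{0,1,2,\dots\}$; $X$ is a complex Banach space; $\mathcal{B}(X)$ is the space of bounded linear operators on $X$; $\rho(A)$ is the resolvent set; $l^\infty(\mathbb{N}_0)$ is the space of bounded scalar sequences; empty sums are $0$. Let $A$ be a closed linear operator with domain $D(A)\subset X$ and let $1<\alpha\le2$. $A$ generates an $\alpha$-resolvent family $S_\alpha$ if there exist $\omega\ge0$ and a strongly continuous $S_\alpha:[0,\infty)\to\mathcal{B}(X)$ such that $\{\lambda^\alpha:\mathrm{Re}\,\lambda>\omega\}\subset\rho(A)$ and $(\lambda^\alpha-A)^{-1}x=\int_0^\infty e^{-\lambda t}S_\alpha(t)x\,dt$ for $\mathrm{Re}\,\lambda>\omega$, $x\in X$. A (strongly continuous) sine family is a $2$-resolvent family; it is bounded if $\sup_{t}\|S(t)\|<\infty$. For $\beta>0$ and $n\in\mathbb{N}_0$, $k^{\beta}(n):=\frac{\Gamma(\beta+n)}{\Gamma(\beta)\Gamma(n+1)}$; for sequences, $(a*v)(n):=\sum_{j=0}^n a(n-j)v(j)$. For $u:\mathbb{N}_0\to X$, $\Delta u(n):=u(n+1)-u(n)$, $\Delta^2:=\Delta\circ\Delta$; for $1<\alpha<2$, $\Delta^{\alpha}u:=\Delta^2(k^{2-\alpha}*u)$, and for $\alpha=2$, $\Delta^\alpha$ is $\Delta^2$. A sequence $\{\mathcal{S}_\alpha(n)\}_{n\in\mathbb{N}_0}\subset\mathcal{B}(X)$ is a discrete $\alpha$-resolvent family generated by $A$ if: (a) $\mathcal{S}_\alpha(n)x\in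 D(A)$ and $\mathcal{S}_\alpha(n)Ax=A\mathcal{S}_\alpha(n)x$ for all $n\in\mathbb{N}_0$, $x\in D(A)$; (b) $(k^\alpha*\mathcal{S}_\alpha)(n)x\in D(A)$ and $\mathcal{S}_\alpha(n)x=k^\alpha(n)x+A(k^\alpha*\mathcal{S}_\alpha)(n)x$ for all $n\in\mathbb{N}_0$, $x\in X$. When $A$ generates a discrete $\alpha$-resolvent family, a solution of the nonlinear problem $\Delta^{\alpha}u(n)=Au(n+2)+f(n,u(n))$, $n\in\mathbb{N}_0$, $u(0)=0$, $u(1)=0$ (with $f:\mathbb{N}_0\times X\to X$) is, by definition, a sequence $u:\mathbb{N}_0\to X$ with $u(0)=u(1)=0$ and $u(n)=\sum_{k=0}^{n-2}\mathcal{S}_\alpha(n-2-k)f(k,u(k))$ for $n=2,3,\dots$. In the setting of the claim, the discrete $\alpha$-resolvent family generated by $A$ is $\mathcal{S}_\alpha(n)x=\int_0^\infty e^{-t}\frac{t^n}{n!}S_\alpha(t)x\,dt$, where $S_\alpha$ is the $\alpha$-resolvent family generated by $A$ (with $S_2=S$). A sequence $h:\mathbb{N}_0\to(0,\infty)$ is an admissible weight if $\lim_{n\to\infty}\frac{1}{h(n)}\sum_{k=0}^{n-2}h(k)=0$. The space $l_h^\infty(\mathbb{N}_0;X)$ consists of all $\xi:\mathbb{N}_0\to X$ with $\|\xi\|_h:=\sup_{n\in\mathbb{N}_0}\frac{\|\xi(n)\|}{h(n)}<\infty$. The Nemytskii operator $\mathcal{N}_f:l_h^\infty(\mathbb{N}_0;X)\to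 l_h^\infty(\mathbb{N}_0;X)$ is $\mathcal{N}_f(u)(n):=f(n,u(n))$. *)

theory Defs
  imports "HOL-Analysis.Analysis"
begin

text \<open>Complex Banach spaces: the real structure of a type of class \<open>banach\<close>, together with a
  complex scalar multiplication that extends \<open>scaleR\<close> and for which the norm is homogeneous.\<close>

class complex_banach = banach +
  fixes scaleC :: "complex \<Rightarrow> 'a \<Rightarrow> 'a"  (infixr "*\<^sub>C" 75)
  assumes scaleC_add_right: "c *\<^sub>C (x + y) = c *\<^sub>C x + c *\<^sub>C y"
    and scaleC_add_left: "(c + d) *\<^sub>C x = c *\<^sub>C x + d *\<^sub>C x"
    and scaleC_scaleC: "c *\<^sub>C d *\<^sub>C x = (c * d) *\<^sub>C x"
    and scaleC_of_real: "complex_of_real r *\<^sub>C x = r *\<^sub>R x"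
    and norm_scaleC: "norm (c *\<^sub>C x) = cmod c * norm x"

instantiation complex :: complex_banach
begin
definition scaleC_complex :: "complex \<Rightarrow> complex \<Rightarrow> complex"
  where "scaleC_complex c x = c * x"
instance
  by standard (auto simp: scaleC_complex_def algebra_simps norm_mult scaleR_conv_of_real)
end

definition bounded_clinear :: "('a::complex_banach \<Rightarrow> 'a) \<Rightarrow> bool"
  where "bounded_clinear T \<longleftrightarrow> bounded_linear T \<and> (\<forall>c x. T (c *\<^sub>C x) = c *\<^sub>C T x)"

definition compact_operator :: "('a::complex_banach \<Rightarrow> 'a) \<Rightarrow> bool"
  where "compact_operator T \<longleftrightarrow>
    bounded_clinear T \<and> (\<forall>B. bounded B \<longrightarrow> compact (closure (T ` B)))"

text \<open>An unbounded operator is given by its domain \<open>D\<close> and a function \<open>A\<close> whose values outside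
  \<open>D\<close> are irrelevant.\<close>

definition closed_operator :: "'a::complex_banach set \<Rightarrow> ('a \<Rightarrow> 'a) \<Rightarrow> bool"
  where "closed_operator D A \<longleftrightarrow>
    0 \<in> D \<and> (\<forall>x\<in>D. \<forall>y\<in>D. x + y \<in> D \<and> A (x + y) = A x + A y) \<and>
    (\<forall>c. \<forall>x\<in>D. c *\<^sub>C x \<in> D \<and> A (c *\<^sub>C x) = c *\<^sub>C A x) \<and>
    closed ((\<lambda>x. (x, A x)) ` D)"

definition resolvent :: "'a::complex_banach set \<Rightarrow> ('a \<Rightarrow> 'a) \<Rightarrow> complex \<Rightarrow> 'a \<Rightarrow> 'a"
  where "resolvent D A \<mu> = inv_into D (\<lambda>x. \<mu> *\<^sub>C x - A x)"

definition resolvent_set :: "'a::complex_banach set \<Rightarrow> ('a \<Rightarrow> 'a) \<Rightarrow> complex set"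
  where "resolvent_set D A =
    {\<mu>. bij_betw (\<lambda>x. \<mu> *\<^sub>C x - A x) D UNIV \<and> bounded_clinear (resolvent D A \<mu>)}"

text \<open>For complex \<open>\<mu>\<close> with positive real part, \<open>\<mu> powr \<alpha>\<close> is the principal branch.  The Laplace
  integral is the Henstock--Kurzweil integral, because the Bochner integral of the library is
  restricted to second countable spaces; for continuous integrands on \<open>{0..}\<close> it is
  the improper Riemann integral.\<close>

definition resolvent_family ::
  "real \<Rightarrow> 'a::complex_banach set \<Rightarrow> ('a \<Rightarrow> 'a) \<Rightarrow> (real \<Rightarrow> 'a \<Rightarrow> 'a) \<Rightarrow> bool"
  where "resolvent_family \<alpha> D A S \<longleftrightarrow>
    (\<forall>t\<ge>0. bounded_clinear (S t)) \<and> (\<forall>x. continuous_on {0..} (\<lambda>t. S t x)) \<and>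
    (\<exists>\<omega>\<ge>0. \<forall>\<mu>. Re \<mu> > \<omega> \<longrightarrow>
       \<mu> powr of_real \<alpha> \<in> resolvent_set D A \<and>
       (\<forall>x. ((\<lambda>t. exp (- \<mu> * of_real t) *\<^sub>C S t x)
               has_integral resolvent D A (\<mu> powr of_real \<alpha>) x) {0..}))"

definition sine_family ::
  "'a::complex_banach set \<Rightarrow> ('a \<Rightarrow> 'a) \<Rightarrow> (real \<Rightarrow> 'a \<Rightarrow> 'a) \<Rightarrow> bool"
  where "sine_family D A S \<longleftrightarrow> resolvent_family 2 D A S"

definition bounded_family :: "(real \<Rightarrow> 'a::complex_banach \<Rightarrow> 'a) \<Rightarrow> bool"
  where "bounded_family S \<longleftrightarrow> bdd_above ((\<lambda>t. onorm (S t)) ` {0..})"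

definition kseq :: "real \<Rightarrow> nat \<Rightarrow> real"
  where "kseq \<beta> n = Gamma (\<beta> + real n) / (Gamma \<beta> * Gamma (real n + 1))"

definition conv :: "(nat \<Rightarrow> real) \<Rightarrow> (nat \<Rightarrow> 'a::real_vector) \<Rightarrow> nat \<Rightarrow> 'a"
  where "conv a v n = (\<Sum>j=0..n. a (n - j) *\<^sub>R v j)"

definition discrete_resolvent_family ::
  "real \<Rightarrow> 'a::complex_banach set \<Rightarrow> ('a \<Rightarrow> 'a) \<Rightarrow> (nat \<Rightarrow> 'a \<Rightarrow> 'a) \<Rightarrow> bool"
  where "discrete_resolvent_family \<alpha> D A R \<longleftrightarrow>
    (\<forall>n. bounded_clinear (R n)) \<and>
    (\<forall>n. \<forall>x\<in>D. R n x \<in> D \<and> R n (A x) = A (R n x)) \<and>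
    (\<forall>n x. conv (kseq \<alpha>) (\<lambda>j. R j x) n \<in> D \<and>
            R n x = kseq \<alpha> n *\<^sub>R x + A (conv (kseq \<alpha>) (\<lambda>j. R j x) n))"

text \<open>An operator generates at most one discrete resolvent family, so the existential quantifier
  over families in the definition of a solution below refers to a unique object.\<close>

lemma discrete_resolvent_family_unique:
  assumes A: "closed_operator D A" and \<alpha>: "\<alpha> > 0"
    and R: "discrete_resolvent_family \<alpha> D A R" and Q: "discrete_resolvent_family \<alpha> D A Q"
  shows "R = Q"
proof -
  have k0: "kseq \<alpha> 0 = 1"
  proof -
    have "Gamma \<alpha> \<noteq> 0" using Gamma_real_pos[OF \<alpha>] by linarith
    then show ?thesis by (simp add: kseq_def)
  qed
  have addD: "x + y \<in> D \<and> A (x + y) = A x + A y" if "x \<in> D" "y \<in> D" for x y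
    using A that unfolding closed_operator_def by blast
  have negD: "- x \<in> D \<and> A (- x) = - A x" if "x \<in> D" for x
  proof -
    have "complex_of_real (-1) *\<^sub>C x \<in> D
        \<and> A (complex_of_real (-1) *\<^sub>C x) = complex_of_real (-1) *\<^sub>C A x"
      using A that unfolding closed_operator_def by blast
    then show ?thesis by (simp only: scaleC_of_real) simp
  qed
  have diffD: "x - y \<in> D \<and> A (x - y) = A x - A y" if "x \<in> D" "y \<in> D" for x y
    using addD[of x "- y"] negD[of y] that by simp
  have inj: "z = 0" if z: "z \<in> D" "A z = z" for z
  proof -
    have "R 0 z = z + A (R 0 z)"
    proof -
      have "R 0 z = kseq \<alpha> 0 *\<^sub>R z + A (conv (kseq \<alpha>) (\<lambda>j. R j z) 0)"
        using R unfolding discrete_resolvent_family_def by blast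
      then show ?thesis by (simp add: conv_def k0)
    qed
    moreover have "R 0 (A z) = A (R 0 z)"
      using R z unfolding discrete_resolvent_family_def by blast
    ultimately show ?thesis using z by simp
  qed
  have "\<forall>x. R n x = Q n x" for n
  proof (induction n rule: less_induct)
    case (less n)
    show ?case
    proof
      fix x
      let ?r = "conv (kseq \<alpha>) (\<lambda>j. R j x) n" and ?q = "conv (kseq \<alpha>) (\<lambda>j. Q j x) n"
      have r: "?r \<in> D" "R n x = kseq \<alpha> n *\<^sub>R x + A ?r"
        using R unfolding discrete_resolvent_family_def by blast+
      have q: "?q \<in> D" "Q n x = kseq \<alpha> n *\<^sub>R x + A ?q"
        using Q unfolding discrete_resolvent_family_def by blast+
      have split: "conv (kseq \<alpha>) v n = (\<Sum>j<n. kseq \<alpha> (n - j) *\<^sub>R v j) + v n"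
        for v :: "nat \<Rightarrow> 'a"
      proof -
        have "{0..n} = insert n {..<n}" by auto
        then show ?thesis by (simp add: conv_def k0)
      qed
      have "(\<Sum>j<n. kseq \<alpha> (n - j) *\<^sub>R R j x) = (\<Sum>j<n. kseq \<alpha> (n - j) *\<^sub>R Q j x)"
        using less by (intro sum.cong) auto
      then have d: "?r - ?q = R n x - Q n x" by (simp add: split)
      have "?r - ?q \<in> D" "A (?r - ?q) = A ?r - A ?q" using diffD r q by blast+
      moreover have "A ?r - A ?q = ?r - ?q" using r(2) q(2) d by simp
      ultimately have "?r - ?q = 0" using inj[of "?r - ?q"] by argo
      then show "R n x = Q n x" using d by simp
    qed
  qed
  then show ?thesis by blast
qed

text \<open>A solution of \<open>\<Delta>\<^sup>\<alpha> u(n) = A u(n+2) + f(n, u(n))\<close>, \<open>u(0) = u(1) = 0\<close>, is by definition a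
  sequence satisfying the variation of constants formula for the discrete resolvent family
  generated by \<open>A\<close>; in particular, the existence of a solution includes that of this family.\<close>

definition is_solution ::
  "real \<Rightarrow> 'a::complex_banach set \<Rightarrow> ('a \<Rightarrow> 'a) \<Rightarrow> (nat \<Rightarrow> 'a \<Rightarrow> 'a) \<Rightarrow> (nat \<Rightarrow> 'a) \<Rightarrow> bool"
  where "is_solution \<alpha> D A f u \<longleftrightarrow>
    (\<exists>R. discrete_resolvent_family \<alpha> D A R \<and> u 0 = 0 \<and> u 1 = 0 \<and>
         (\<forall>n\<ge>2. u n = (\<Sum>k=0..n-2. R (n - 2 - k) (f k (u k)))))"

text \<open>The index set \<open>{..<n-1}\<close> is \<open>{0,\<dots>,n-2}\<close> for \<open>n \<ge> 2\<close>, and is empty for \<open>n < 2\<close>.\<close>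

definition admissible_weight :: "(nat \<Rightarrow> real) \<Rightarrow> bool"
  where "admissible_weight h \<longleftrightarrow>
    (\<forall>n. h n > 0) \<and> (\<lambda>n. (1 / h n) * (\<Sum>k<n-1. h k)) \<longlonglongrightarrow> 0"

definition linf_weighted :: "(nat \<Rightarrow> real) \<Rightarrow> (nat \<Rightarrow> 'a::real_normed_vector) set"
  where "linf_weighted h = {\<xi>. bdd_above (range (\<lambda>n. norm (\<xi> n) / h n))}"

definition norm_weighted :: "(nat \<Rightarrow> real) \<Rightarrow> (nat \<Rightarrow> 'a::real_normed_vector) \<Rightarrow> real"
  where "norm_weighted h \<xi> = (SUP n. norm (\<xi> n) / h n)"

definition continuous_weighted ::
  "(nat \<Rightarrow> real) \<Rightarrow> ((nat \<Rightarrow> 'a::real_normed_vector) \<Rightarrow> nat \<Rightarrow> 'a) \<Rightarrow> bool"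
  where "continuous_weighted h N \<longleftrightarrow>
    N ` linf_weighted h \<subseteq> linf_weighted h \<and>
    (\<forall>\<xi>\<in>linf_weighted h. \<forall>\<epsilon>>0. \<exists>\<delta>>0. \<forall>\<eta>\<in>linf_weighted h.
       norm_weighted h (\<lambda>n. \<eta> n - \<xi> n) < \<delta> \<longrightarrow> norm_weighted h (\<lambda>n. N \<eta> n - N \<xi> n) < \<epsilon>)"

definition nemytskii :: "(nat \<Rightarrow> 'a \<Rightarrow> 'a) \<Rightarrow> (nat \<Rightarrow> 'a) \<Rightarrow> nat \<Rightarrow> 'a"
  where "nemytskii f u n = f n (u n)"

end

theory Submission
  imports Defs "HOL-Computational_Algebra.Formal_Power_Series"
begin

text \<open>
  The variation of constants formula expresses \<open>u n\<close> through \<open>u 0, \<dots>, u (n - 2)\<close> only, so as soon as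
  \<open>A\<close> generates a discrete resolvent family \<open>R\<close> there is exactly one solution, given by recursion
  (\<open>is_solution_iff_volterra_solution\<close>). What has to be shown is that this family exists and that the
  solution lies in the weighted space. If \<open>norm (R n x) \<le> B * norm x\<close> uniformly in \<open>n\<close>, the linear growth
  of \<open>f\<close> gives \<open>norm (u n) \<le> K * (\<Sum>k<n-1. norm (u k))\<close>, and an admissible weight grows so fast that this
  recursive inequality alone forces \<open>norm (u n) \<le> const * h n\<close> (\<open>admissible_weight_gronwall\<close>).

  A uniformly bounded family comes from generating functions. If \<open>C\<close> bounds the sine family, then for
  \<open>L\<close> large enough
  \[ ((L - z)^2 - A)^{-1} x = \int_0^\infty e^{-(L-z)t} S(t) x \, dt = \sum_n z^n G_n x, \qquad
     G_n x = \int_0^\infty e^{-Lt} \frac{t^n}{n!} S(t) x \, dt, \]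
  whence \<open>norm (G n x) \<le> C * norm x / L ^ (n + 1)\<close> (\<open>sine_family_resolvent_taylor\<close>).
  On the other hand, a discrete \<open>\<alpha>\<close>-resolvent family is one with
  \<open>\<Sum>n. w ^ n * R n = ((1 - w) powr \<alpha> - A)\<^sup>-\<^sup>1\<close>. With \<open>\<gamma> = \<alpha> / 2\<close> this is the first series at
  \<open>z = e w\<close>, where \<open>e w = L - (1 - w) powr \<gamma>\<close>; hence \<open>R n\<close> is the sum over \<open>j\<close> of the \<open>n\<close>-th coefficient
  of \<open>e ^ j\<close> times \<open>G j\<close>. Because \<open>\<gamma> \<le> 1\<close>, the power series \<open>e\<close> has nonnegative coefficients, so the norms
  are dominated by the coefficients of
  \<open>\<Sum>j. C * e w ^ j / L ^ (j + 1) = C / (L - e w) = C * (1 - w) powr (- \<gamma>)\<close>, none of which exceeds \<open>C\<close>.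
  This is a discrete form of the subordination of resolvent families. It works with formal power series
  in \<open>w\<close>, so that the only convergence in question is that of the sum over \<open>j\<close>
  (\<open>bounded_discrete_resolvent_family_exists\<close>).
\<close>

unbundle no vec_syntax
unbundle fps_syntax

section \<open>Integrals over the half-line and vector-valued power series\<close>

text \<open>The tails of the integral of \<open>f\<close> are dominated by those of \<open>g\<close>, so the Cauchy criterion applies; it
  uses only completeness, hence the values may lie in any Banach space.\<close>

lemma integrable_on_halfline_dominated:
  fixes f :: "real \<Rightarrow> 'a::banach"
  assumes cont: "continuous_on {0..} f" and g: "g integrable_on {0..}"
    and le: "\<And>t. t \<ge> 0 \<Longrightarrow> norm (f t) \<le> g t"
  shows "f integrable_on {0..}"
proof -
  let ?F = "\<lambda>t. if t \<in> {0..} then f t else 0" and ?G = "\<lambda>t. if t \<in> {0..} then g t else 0"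
  have intf: "f integrable_on {a..b}" if "a \<ge> 0" for a b
    using that by (intro integrable_continuous_real continuous_on_subset[OF cont]) auto
  have intg: "g integrable_on {a..b}" if "a \<ge> 0" for a b
    using that by (intro integrable_on_subinterval[OF g]) auto
  have restr: "integral {a..b} (\<lambda>t. if t \<in> {0..} then k t else 0) = integral {0..b} k"
    if "a < 0" for a b and k :: "real \<Rightarrow> 'b::banach"
  proof -
    have "{0..} \<inter> {a..b} = {0..b}" using that by auto
    then show ?thesis by (simp only: integral_restrict_Int)
  qed
  show ?thesis
  proof (rule iffD2[OF integrable_alt_subset], intro conjI allI impI)
    fix a b :: real
    have "{0..} \<inter> cbox a b = {max 0 a..b}" by (rule set_eqI) simp
    then show "?F integrable_on cbox a b"
      using intf[of "max 0 a" b] by (simp add: integrable_restrict_Int del: atLeast_iff)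
  next
    fix e :: real assume "e > 0"
    then obtain B where B: "B > 0" and small:
      "\<And>a b c d. ball 0 B \<subseteq> cbox a b \<Longrightarrow> cbox a b \<subseteq> cbox c d
        \<Longrightarrow> norm (integral (cbox a b) ?G - integral (cbox c d) ?G) < e"
      using iffD1[OF integrable_alt_subset g] by meson
    show "\<exists>B>0. \<forall>a b c d. ball 0 B \<subseteq> cbox a b \<and> cbox a b \<subseteq> cbox c d \<longrightarrow>
            norm (integral (cbox a b) ?F - integral (cbox c d) ?F) < e"
    proof (intro exI[of _ B] conjI B allI impI)
      fix a b c d :: real
      assume sub: "ball 0 B \<subseteq> cbox a b \<and> cbox a b \<subseteq> cbox c d"
      have "- B/2 \<in> ball 0 B" "B/2 \<in> ball 0 B" using B by auto
      then have "- B/2 \<in> {a..b}" "B/2 \<in> {a..b}" using sub by (metis box_real(2) subsetD)+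
      then have ab: "a < 0" "0 < b" using B by auto
      have "cbox a b \<subseteq> cbox c d" using sub by blast
      then have cd: "c < 0" "b \<le> d" using ab by auto
      have split: "integral {0..d} k = integral {0..b} k + integral {b..d} k"
        if "\<And>a b. a \<ge> 0 \<Longrightarrow> k integrable_on {a..b}" for k :: "real \<Rightarrow> 'b::banach"
        using Henstock_Kurzweil_Integration.integral_combine[of 0 b d k] that[of 0 d] ab cd by simp
      have "norm (integral (cbox a b) ?F - integral (cbox c d) ?F) = norm (integral {b..d} f)"
        using ab cd split[of f, OF intf] by (simp add: restr del: atLeast_iff)
      also have "\<dots> \<le> integral {b..d} g"
        using ab le by (intro integral_norm_bound_integral intf intg) auto
      also have "\<dots> \<le> norm (integral (cbox a b) ?G - integral (cbox c d) ?G)"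
        using ab cd split[of g, OF intg] by (simp add: restr del: atLeast_iff)
      also have "\<dots> < e" using small sub by blast
      finally show "norm (integral (cbox a b) ?F - integral (cbox c d) ?F) < e" .
    qed
  qed
qed

text \<open>Repeated integration by parts yields the explicit antiderivative \<open>F n\<close> used below.\<close>

lemma has_integral_exp_times_power:
  fixes L :: real
  assumes L: "L > 0"
  shows "((\<lambda>t. exp (- L * t) * (t ^ n / fact n)) has_integral 1 / L ^ Suc n) {0..}"
proof (rule has_integral_to_inf)
  define F where "F n t = - exp (- L * t) * (\<Sum>i\<le>n. (L * t) ^ i / fact i) / L ^ Suc n" for n t
  have F_Suc: "F (Suc n) t = F n t / L - exp (- L * t) * (t ^ Suc n / fact (Suc n)) / L" for n t
    using L by (simp add: F_def divide_simps) (simp add: algebra_simps)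
  have deriv: "(F n has_real_derivative exp (- L * t) * (t ^ n / fact n)) (at t within X)" for n t X
  proof (induction n)
    case 0
    then show ?case unfolding F_def using L by (auto intro!: derivative_eq_intros)
  next
    case (Suc n)
    have "((\<lambda>t. t ^ Suc n / fact (Suc n)) has_real_derivative t ^ n / fact n) (at t within X)"
      by (rule DERIV_cong[OF DERIV_cdivide[OF DERIV_pow]]) (simp del: of_nat_Suc)
    note * = DERIV_diff[OF DERIV_cdivide[OF Suc, of L]
        DERIV_cdivide[OF DERIV_mult[OF _ this, of "\<lambda>t. exp (- L * t)" "- L * exp (- L * t)"], of L]]
    have "((\<lambda>t. F n t / L - exp (- L * t) * (t ^ Suc n / fact (Suc n)) / L)
        has_real_derivative exp (- L * t) * (t ^ Suc n / fact (Suc n))) (at t within X)"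
      by (rule DERIV_cong[OF *])
        (use L in \<open>auto intro!: derivative_eq_intros simp: divide_simps simp del: of_nat_Suc fact_Suc power_Suc\<close>)
    then show ?case by (simp add: F_Suc[abs_def])
  qed
  have lim: "(F n \<longlongrightarrow> 0) at_top" for n
  proof -
    have *: "((\<lambda>t. (L * t) ^ i / exp (L * t)) \<longlongrightarrow> 0) at_top" for i
      using L by (intro filterlim_compose[OF tendsto_power_div_exp_0]
          filterlim_tendsto_pos_mult_at_top[OF tendsto_const] filterlim_ident)
    have "F n = (\<lambda>t. - (\<Sum>i\<le>n. (L * t) ^ i / exp (L * t) / fact i) / L ^ Suc n)"
      by (rule ext) (simp add: F_def exp_minus divide_inverse sum_distrib_left sum_negf mult_ac)
    moreover have "((\<lambda>t. - (\<Sum>i\<le>n. (L * t) ^ i / exp (L * t) / fact i) / L ^ Suc n)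
        \<longlongrightarrow> - (\<Sum>i\<le>n. 0 / fact i) / L ^ Suc n) at_top"
      using L by (intro tendsto_intros *) auto
    ultimately show ?thesis by simp
  qed
  show "(\<lambda>t. exp (- L * t) * (t ^ n / fact n)) integrable_on {0..y}" for y
    by (intro integrable_continuous_real continuous_intros) auto
  have "((\<lambda>t. exp (- L * t) * (t ^ n / fact n)) has_integral (F n y - F n 0)) {0..y}" if "0 \<le> y" for y
    by (rule fundamental_theorem_of_calculus[OF that])
      (use deriv in \<open>simp add: has_real_derivative_iff_has_vector_derivative\<close>)
  then have "\<forall>\<^sub>F y in at_top. F n y - F n 0 = integral {0..y} (\<lambda>t. exp (- L * t) * (t ^ n / fact n))"
    by (intro eventually_mono[OF eventually_ge_at_top[of 0]]) (rule integral_unique[symmetric])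
  moreover have "((\<lambda>y. F n y - F n 0) \<longlongrightarrow> 0 - F n 0) at_top"
    by (intro tendsto_intros lim)
  moreover have "F n 0 = - 1 / L ^ Suc n"
    unfolding F_def by (subst sum.atMost_shift) simp
  ultimately show "((\<lambda>y. integral {0..y} (\<lambda>t. exp (- L * t) * (t ^ n / fact n)))
      \<longlongrightarrow> 1 / L ^ Suc n) at_top"
    by (auto elim!: Lim_transform_eventually)
qed auto

text \<open>Values at small positive \<open>z\<close> suffice for uniqueness of vector-valued power series: once the
  coefficients below \<open>n\<close> vanish, dividing by \<open>z ^ n\<close> shows that \<open>b n\<close> is \<open>O(z)\<close>.\<close>

lemma power_series_coeffs_eq_0:
  fixes b :: "nat \<Rightarrow> 'a::banach"
  assumes r: "r > 0" and abs: "summable (\<lambda>n. r ^ n * norm (b n))"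
    and zero: "\<And>z::real. 0 < z \<Longrightarrow> z < r \<Longrightarrow> (\<lambda>n. z ^ n *\<^sub>R b n) sums 0"
  shows "b n = 0"
proof (induction n rule: less_induct)
  case (less n)
  define K where "K = (\<Sum>m. r ^ m * norm (b (m + Suc n)))"
  have sumK: "summable (\<lambda>m. r ^ m * norm (b (m + Suc n)))"
  proof -
    have "summable (\<lambda>m. r ^ (m + Suc n) * norm (b (m + Suc n)))"
      using abs by (subst summable_iff_shift)
    then have "summable (\<lambda>m. (1 / r ^ Suc n) * (r ^ (m + Suc n) * norm (b (m + Suc n))))"
      by (rule summable_mult)
    then show ?thesis using r by (simp add: power_add field_simps)
  qed
  have bound: "norm (b n) \<le> z * K" if z: "0 < z" "z < r" for z
  proof -
    have le: "norm (z ^ m *\<^sub>R b (m + Suc n)) \<le> r ^ m * norm (b (m + Suc n))" for m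
      using z by (auto intro!: mult_right_mono power_mono)
    have sn: "summable (\<lambda>m. norm (z ^ m *\<^sub>R b (m + Suc n)))"
      by (rule summable_comparison_test'[OF sumK]) (use le in simp)
    define s where "s = (\<Sum>m. z ^ m *\<^sub>R b (m + Suc n))"
    have s: "(\<lambda>m. z ^ m *\<^sub>R b (m + Suc n)) sums s"
      unfolding s_def by (rule summable_sums[OF summable_norm_cancel[OF sn]])
    have "norm s \<le> (\<Sum>m. norm (z ^ m *\<^sub>R b (m + Suc n)))"
      unfolding s_def by (rule summable_norm[OF sn])
    also have "\<dots> \<le> K"
      unfolding K_def by (rule suminf_le[OF le sn sumK])
    finally have "norm s \<le> K" .
    have "(\<lambda>m. z ^ (m + Suc n) *\<^sub>R b (m + Suc n)) sums (z ^ Suc n *\<^sub>R s)"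
      using sums_scaleR_right[OF s, of "z ^ Suc n"] by (simp add: power_add mult_ac)
    then have "(\<lambda>m. z ^ m *\<^sub>R b m) sums (z ^ Suc n *\<^sub>R s + (\<Sum>m<Suc n. z ^ m *\<^sub>R b m))"
      by (subst (asm) sums_iff_shift)
    moreover have "(\<Sum>m<Suc n. z ^ m *\<^sub>R b m) = z ^ n *\<^sub>R b n"
      using less by simp
    ultimately have "z ^ Suc n *\<^sub>R s + z ^ n *\<^sub>R b n = 0"
      using sums_unique2[OF zero[OF z]] by simp
    then have "z ^ n *\<^sub>R (z *\<^sub>R s + b n) = 0" by (simp add: scaleR_add_right mult.commute)
    then have "b n = - (z *\<^sub>R s)" using z by (simp add: eq_neg_iff_add_eq_0 add.commute)
    then show ?thesis using z \<open>norm s \<le> K\<close> by simp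
  qed
  have "((\<lambda>z. z * K) \<longlongrightarrow> 0 * K) (at_right 0)" by (intro tendsto_intros)
  moreover have "\<forall>\<^sub>F z in at_right 0. norm (b n) \<le> z * K"
    using bound r by (auto simp: eventually_at_right_field)
  ultimately have "norm (b n) \<le> 0 * K"
    by (intro tendsto_lowerbound) auto
  then show ?case by simp
qed

section \<open>Formal power series with nonnegative coefficients\<close>

text \<open>The formal power series of \<open>(1 - w) powr (- b)\<close>; its coefficients are the numbers \<open>kseq b n\<close>
  when \<open>b > 0\<close>, while a negative \<open>b\<close> gives the series of the powers \<open>(1 - w) powr \<gamma>\<close> to be substituted.\<close>

definition neg_binomial_fps :: "real \<Rightarrow> real fps"
  where "neg_binomial_fps b = Abs_fps (\<lambda>n. pochhammer b n / fact n)"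

lemma neg_binomial_fps_mult:
  "neg_binomial_fps a * neg_binomial_fps b = neg_binomial_fps (a + b)"
proof (rule fps_ext)
  fix n
  have "(neg_binomial_fps a * neg_binomial_fps b) $ n =
      (\<Sum>i\<le>n. real (n choose i) * pochhammer a i * pochhammer b (n - i) / fact n)"
    unfolding fps_mult_nth atLeast0AtMost
    by (rule sum.cong) (simp_all add: neg_binomial_fps_def binomial_fact)
  also have "\<dots> = neg_binomial_fps (a + b) $ n"
    by (simp add: neg_binomial_fps_def pochhammer_binomial_sum sum_divide_distrib)
  finally show "(neg_binomial_fps a * neg_binomial_fps b) $ n = neg_binomial_fps (a + b) $ n" .
qed

lemma neg_binomial_fps_0: "neg_binomial_fps 0 = 1"
  by (rule fps_ext) (simp add: neg_binomial_fps_def pochhammer_0_left)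

lemma kseq_eq_neg_binomial_fps:
  assumes "b > 0"
  shows "kseq b n = neg_binomial_fps b $ n"
proof -
  have "pochhammer b n = Gamma (b + real n) / Gamma b"
    using assms by (intro pochhammer_Gamma) (auto elim!: nonpos_Ints_cases')
  moreover have "Gamma (real n + 1) = fact n"
    using Gamma_fact[of n, where ?'a = real] by (simp add: add.commute)
  ultimately show ?thesis by (simp add: kseq_def neg_binomial_fps_def)
qed

lemma neg_binomial_fps_nonneg: "0 \<le> b \<Longrightarrow> 0 \<le> neg_binomial_fps b $ n"
  by (simp add: neg_binomial_fps_def pochhammer_nonneg pochhammer_prod prod_nonneg)

lemma neg_binomial_fps_le_1:
  assumes "0 \<le> b" "b \<le> 1"
  shows "neg_binomial_fps b $ n \<le> 1"
proof -
  have "pochhammer b n \<le> pochhammer 1 n"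
    unfolding pochhammer_prod using assms by (intro prod_mono) auto
  then show ?thesis by (simp add: neg_binomial_fps_def pochhammer_fact[symmetric])
qed

lemma neg_binomial_fps_minus_nonpos:
  assumes "0 \<le> g" "g \<le> 1" "n > 0"
  shows "neg_binomial_fps (- g) $ n \<le> 0"
proof -
  obtain m where n: "n = Suc m" using assms(3) by (cases n) auto
  have "0 \<le> g * pochhammer (1 - g) m"
    using assms by (auto simp: pochhammer_prod intro!: mult_nonneg_nonneg prod_nonneg)
  then show ?thesis by (simp add: neg_binomial_fps_def n pochhammer_rec divide_le_0_iff)
qed

lemma fps_power_nonneg:
  fixes e :: "real fps"
  assumes "\<And>n. 0 \<le> e $ n"
  shows "0 \<le> (e ^ j) $ n"
proof (induction j arbitrary: n)
  case (Suc j)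
  then show ?case using assms by (auto simp: fps_mult_nth intro!: sum_nonneg)
qed simp

text \<open>The formal inverse of \<open>L - e\<close> ought to be the geometric series in \<open>e / L\<close>, but the constant term
  of \<open>e\<close> need not vanish, so this series converges only coefficientwise in the analytic sense. Its
  partial sums differ from \<open>k\<close> by \<open>k * e ^ J / L ^ J\<close>, which is nonnegative; boundedness by \<open>k\<close> and hence
  convergence follow without any estimate of that remainder.\<close>

lemma fps_geometric_bound:
  fixes e k :: "real fps" and L :: real
  assumes L: "L > 0" and e: "\<And>n. 0 \<le> e $ n" and k: "\<And>n. 0 \<le> k $ n"
    and inv: "(fps_const L - e) * k = 1"
  shows "summable (\<lambda>j. (e ^ j) $ n / L ^ Suc j)" "(\<Sum>j. (e ^ j) $ n / L ^ Suc j) \<le> k $ n"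
proof -
  have partial: "(\<Sum>j<J. (e ^ j) $ n / L ^ Suc j) \<le> k $ n" for J
  proof -
    define E where "E J = (\<Sum>j<J. fps_const (1 / L ^ Suc j) * e ^ j)" for J
    have telescope: "(fps_const L - e) * E J = 1 - fps_const (1 / L ^ J) * e ^ J" for J
    proof (induction J)
      case (Suc J)
      have "L * (1 / L ^ Suc J) = 1 / L ^ J" using L by simp
      then have "fps_const L * fps_const (1 / L ^ Suc J) = fps_const (1 / L ^ J)"
        by (simp only: fps_const_mult)
      moreover have "(x - e) * (y * e ^ J) = x * y * e ^ J - y * e ^ Suc J" for x y :: "real fps"
        by (simp only: left_diff_distrib right_diff_distrib power_Suc mult_ac)
      ultimately have "(fps_const L - e) * (fps_const (1 / L ^ Suc J) * e ^ J)
          = fps_const (1 / L ^ J) * e ^ J - fps_const (1 / L ^ Suc J) * e ^ Suc J"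
        by metis
      moreover have "E (Suc J) = E J + fps_const (1 / L ^ Suc J) * e ^ J"
        unfolding E_def by (rule sum.lessThan_Suc)
      ultimately show ?case using Suc
        by (simp only: distrib_left) (simp only: diff_add_eq_diff_diff_swap diff_add_cancel add_diff_eq)
    qed (simp add: E_def)
    have "E J = k * ((fps_const L - e) * E J)"
      using inv by (metis mult.assoc mult.commute mult.left_neutral)
    then have "E J = k - fps_const (1 / L ^ J) * (k * e ^ J)"
      unfolding telescope by (simp only: right_diff_distrib mult.right_neutral mult.left_commute)
    then have "E J $ n = k $ n - 1 / L ^ J * (k * e ^ J) $ n"
      by (simp only: fps_sub_nth fps_mult_left_const_nth)
    moreover have "0 \<le> (k * e ^ J) $ n"
      using k fps_power_nonneg[OF e] by (auto simp: fps_mult_nth intro!: sum_nonneg)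
    ultimately have "E J $ n \<le> k $ n" using L by simp
    then show ?thesis by (simp add: E_def fps_sum_nth)
  qed
  show s: "summable (\<lambda>j. (e ^ j) $ n / L ^ Suc j)"
    by (rule summableI_nonneg_bounded[OF _ partial]) (use L fps_power_nonneg[OF e] in simp)
  show "(\<Sum>j. (e ^ j) $ n / L ^ Suc j) \<le> k $ n"
    by (rule suminf_le_const[OF s partial])
qed

text \<open>Convolution of the composed family with a sequence amounts to multiplying the generating function
  by a power series; it involves finitely many indices \<open>i\<close>, so no exchange of limits occurs.\<close>

lemma conv_fps_sums:
  fixes v :: "nat \<Rightarrow> 'a::real_normed_vector"
  assumes "\<And>i. (\<lambda>j. ((e ^ j) $ i) *\<^sub>R v j) sums r i"
  shows "(\<lambda>j. ((a * e ^ j) $ n) *\<^sub>R v j) sums conv (fps_nth a) r n"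
proof -
  have "(\<lambda>j. \<Sum>i=0..n. (a $ (n - i)) *\<^sub>R (((e ^ j) $ i) *\<^sub>R v j)) sums conv (fps_nth a) r n"
    unfolding conv_def by (intro sums_sum sums_scaleR_right assms)
  moreover have "(\<Sum>i=0..n. (a $ (n - i)) *\<^sub>R (((e ^ j) $ i) *\<^sub>R v j)) = ((a * e ^ j) $ n) *\<^sub>R v j" for j
    unfolding mult.commute[of a] fps_mult_nth scaleR_sum_left
    by (simp add: mult.commute)
  ultimately show ?thesis by simp
qed

text \<open>Multiplication of the generating function by its variable, that is, the right shift padded by
  \<open>0\<close>.\<close>

definition delay :: "(nat \<Rightarrow> 'a::zero) \<Rightarrow> nat \<Rightarrow> 'a"
  where "delay v n = (case n of 0 \<Rightarrow> 0 | Suc m \<Rightarrow> v m)"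

lemma delay_simps [simp]: "delay v 0 = 0" "delay v (Suc n) = v n"
  by (simp_all add: delay_def)

text \<open>Delaying the inner coefficients is multiplication of the composed series by the inner
  series \<open>e\<close>.\<close>

lemma sums_delay:
  fixes v :: "nat \<Rightarrow> 'a::real_normed_vector"
  assumes "(\<lambda>j. ((a * e * e ^ j) $ n) *\<^sub>R v j) sums s"
  shows "(\<lambda>j. ((a * e ^ j) $ n) *\<^sub>R delay v j) sums s"
  using sums_Suc[of "\<lambda>j. ((a * e ^ j) $ n) *\<^sub>R delay v j" s] assms by (simp add: mult.assoc)

section \<open>Closed operators and resolvents\<close>

lemma closed_operator_scaleR:
  assumes "closed_operator D A" "x \<in> D"
  shows "r *\<^sub>R x \<in> D" "A (r *\<^sub>R x) = r *\<^sub>R A x"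
proof -
  have "complex_of_real r *\<^sub>C x \<in> D \<and> A (complex_of_real r *\<^sub>C x) = complex_of_real r *\<^sub>C A x"
    using assms unfolding closed_operator_def by blast
  then show "r *\<^sub>R x \<in> D" "A (r *\<^sub>R x) = r *\<^sub>R A x" by (simp_all add: scaleC_of_real)
qed

lemma closed_operator_add:
  assumes "closed_operator D A" "x \<in> D" "y \<in> D"
  shows "x + y \<in> D" "A (x + y) = A x + A y"
  using assms unfolding closed_operator_def by blast+

lemma closed_operator_diff:
  assumes "closed_operator D A" "x \<in> D" "y \<in> D"
  shows "x - y \<in> D" "A (x - y) = A x - A y"
  using closed_operator_add[OF assms(1,2) closed_operator_scaleR(1)[OF assms(1,3), of "-1"]]
    closed_operator_scaleR(2)[OF assms(1,3), of "-1"] by simp_all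

lemma closed_operator_sum:
  assumes "closed_operator D A" "\<And>i. i \<in> I \<Longrightarrow> v i \<in> D"
  shows "sum v I \<in> D \<and> A (sum v I) = (\<Sum>i\<in>I. A (v i))"
proof -
  have "0 \<in> D" "A 0 = 0"
    using assms(1) closed_operator_scaleR(2)[OF assms(1), of 0 0]
    by (auto simp: closed_operator_def)
  then show ?thesis
    using assms(2)
    by (induction I rule: infinite_finite_induct) (auto simp: closed_operator_add[OF assms(1)])
qed

lemma closed_operator_sums:
  assumes A: "closed_operator D A" and v: "\<And>i. v i \<in> D"
    and s: "v sums s" and t: "(\<lambda>i. A (v i)) sums t"
  shows "s \<in> D" "A s = t"
proof -
  have "(\<lambda>n. (\<Sum>i<n. v i, \<Sum>i<n. A (v i))) \<longlonglongrightarrow> (s, t)"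
    using s t unfolding sums_def by (rule tendsto_Pair)
  moreover have "\<forall>n. (\<Sum>i<n. v i, \<Sum>i<n. A (v i)) \<in> (\<lambda>x. (x, A x)) ` D"
  proof
    fix n
    show "(\<Sum>i<n. v i, \<Sum>i<n. A (v i)) \<in> (\<lambda>x. (x, A x)) ` D"
      using closed_operator_sum[OF A, of "{..<n}" v] v by (auto intro!: rev_image_eqI)
  qed
  moreover have "closed ((\<lambda>x. (x, A x)) ` D)"
    using A by (simp add: closed_operator_def)
  ultimately have "(s, t) \<in> (\<lambda>x. (x, A x)) ` D"
    by (meson closed_sequentially)
  then show "s \<in> D" "A s = t" by auto
qed

lemma bounded_clinearD:
  assumes "bounded_clinear T"
  shows "T (x + y) = T x + T y" "T (x - y) = T x - T y" "T (r *\<^sub>R x) = r *\<^sub>R T x"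
    "T (c *\<^sub>C x) = c *\<^sub>C T x" "T 0 = 0"
proof -
  interpret bounded_linear T using assms by (simp add: bounded_clinear_def)
  show "T (x + y) = T x + T y" "T (x - y) = T x - T y" "T (r *\<^sub>R x) = r *\<^sub>R T x" "T 0 = 0"
    by (simp_all add: add diff scale zero)
  show "T (c *\<^sub>C x) = c *\<^sub>C T x" using assms by (simp add: bounded_clinear_def)
qed

lemma scaleC_scaleR_commute: "c *\<^sub>C (r *\<^sub>R x) = r *\<^sub>R (c *\<^sub>C (x::'a::complex_banach))"
  by (simp add: scaleC_of_real[symmetric] scaleC_scaleC mult.commute)

lemma scaleC_diff_right: "c *\<^sub>C (x - y) = c *\<^sub>C x - c *\<^sub>C (y::'a::complex_banach)"
  using scaleC_add_right[of c "x - y" y] by simp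

lemma bounded_linear_scaleC: "bounded_linear (\<lambda>x::'a::complex_banach. c *\<^sub>C x)"
  by (rule bounded_linear_intro[of _ "cmod c"])
    (simp_all add: scaleC_add_right scaleC_scaleR_commute norm_scaleC)

lemma resolvent_props:
  assumes "\<mu> \<in> resolvent_set D A"
  shows "resolvent D A \<mu> x \<in> D" "\<mu> *\<^sub>C resolvent D A \<mu> x - A (resolvent D A \<mu> x) = x"
    "y \<in> D \<Longrightarrow> resolvent D A \<mu> (\<mu> *\<^sub>C y - A y) = y"
proof -
  let ?g = "\<lambda>x. \<mu> *\<^sub>C x - A x"
  have g: "bij_betw ?g D UNIV" using assms by (simp add: resolvent_set_def)
  then have x: "x \<in> ?g ` D" by (simp add: bij_betw_def)
  show "resolvent D A \<mu> x \<in> D" unfolding resolvent_def by (rule inv_into_into[OF x])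
  show "\<mu> *\<^sub>C resolvent D A \<mu> x - A (resolvent D A \<mu> x) = x"
    unfolding resolvent_def using f_inv_into_f[OF x] .
  show "y \<in> D \<Longrightarrow> resolvent D A \<mu> (?g y) = y"
    unfolding resolvent_def using g by (intro inv_into_f_f) (auto simp: bij_betw_def)
qed

text \<open>With \<open>Q = (L\<^sup>2 - A)\<^sup>-\<^sup>1\<close> the resolvent identity for \<open>F z = ((L - z)\<^sup>2 - A)\<^sup>-\<^sup>1\<close> reads
  \<open>F z = Q + (2 * L * z - z\<^sup>2) Q (F z)\<close>, and comparing coefficients gives this recursion for the Taylor
  coefficients of \<open>F\<close>. As polynomials in \<open>Q\<close> they inherit linearity and commutation with \<open>A\<close>.\<close>

fun resolvent_coeff :: "('a::real_vector \<Rightarrow> 'a) \<Rightarrow> real \<Rightarrow> nat \<Rightarrow> 'a \<Rightarrow> 'a" where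
  "resolvent_coeff Q L 0 x = Q x"
| "resolvent_coeff Q L (Suc 0) x = Q ((2 * L) *\<^sub>R Q x)"
| "resolvent_coeff Q L (Suc (Suc n)) x
    = Q ((2 * L) *\<^sub>R resolvent_coeff Q L (Suc n) x - resolvent_coeff Q L n x)"

lemma bounded_clinear_resolvent_coeff:
  assumes Q: "bounded_clinear Q"
  shows "bounded_clinear (resolvent_coeff Q L n)"
proof (induction n rule: induct_nat_012)
  have Q': "bounded_linear Q" using Q by (simp add: bounded_clinear_def)
  have comp: "bounded_linear (\<lambda>x. Q (g x))" if "bounded_linear g" for g
    by (rule bounded_linear_compose[OF Q' that])
  note * = bounded_clinear_def bounded_clinearD[OF Q] scaleC_diff_right scaleC_scaleR_commute
  case 0
  then show ?case using Q by (simp add: bounded_clinear_def)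
  case 1
  then show ?case using Q' by (auto simp: * intro!: comp bounded_linear_intros)
  case (ge2 n)
  then show ?case using Q'
    by (auto simp: * intro!: comp bounded_linear_sub bounded_linear_intros)
qed

lemma resolvent_coeff_delay:
  assumes "Q 0 = 0"
  shows "resolvent_coeff Q L n x
    = Q ((if n = 0 then x else 0) + (2 * L) *\<^sub>R delay (\<lambda>j. resolvent_coeff Q L j x) n
        - delay (delay (\<lambda>j. resolvent_coeff Q L j x)) n)"
  by (induction n rule: induct_nat_012) (simp_all add: assms)

lemma resolvent_coeff_unique:
  assumes Q: "bounded_clinear Q"
    and H: "\<And>n. H n = (if n = 0 then Q x else 0) + (2 * L) *\<^sub>R Q (delay H n) - Q (delay (delay H) n)"
  shows "H n = resolvent_coeff Q L n x"
proof (induction n rule: induct_nat_012)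
  case 0
  show ?case using H[of 0] by (simp add: bounded_clinearD[OF Q])
next
  case 1
  show ?case using H[of 1] H[of 0] by (simp add: bounded_clinearD[OF Q])
next
  case (ge2 n)
  then show ?case using H[of "Suc (Suc n)"] by (simp add: bounded_clinearD[OF Q])
qed

section \<open>Laplace transforms and Taylor coefficients of the resolvent\<close>

text \<open>The \<open>n\<close>-th Taylor coefficient at \<open>z = 0\<close> of the Laplace transform of \<open>s\<close> at \<open>L - z\<close>.\<close>

definition laplace_coeff :: "real \<Rightarrow> (real \<Rightarrow> 'a::banach) \<Rightarrow> nat \<Rightarrow> 'a"
  where "laplace_coeff L s n = integral {0..} (\<lambda>t. (exp (- L * t) * (t ^ n / fact n)) *\<^sub>R s t)"

lemma laplace_coeff_has_integral:
  fixes s :: "real \<Rightarrow> 'a::banach"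
  assumes cont: "continuous_on {0..} s" and bound: "\<And>t. t \<ge> 0 \<Longrightarrow> norm (s t) \<le> c" and L: "L > 0"
  shows "((\<lambda>t. (exp (- L * t) * (t ^ n / fact n)) *\<^sub>R s t) has_integral laplace_coeff L s n) {0..}"
    and "norm (laplace_coeff L s n) \<le> c / L ^ Suc n"
proof -
  let ?w = "\<lambda>t. exp (- L * t) * (t ^ n / fact n)"
  have w: "((\<lambda>t. ?w t * c) has_integral (1 / L ^ Suc n * c)) {0..}"
    by (rule has_integral_mult_left[OF has_integral_exp_times_power[OF L]])
  have le: "norm (?w t *\<^sub>R s t) \<le> ?w t * c" if "t \<ge> 0" for t
    using bound[OF that] that by (simp add: mult_left_mono divide_right_mono)
  have int: "(\<lambda>t. ?w t *\<^sub>R s t) integrable_on {0..}"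
    by (rule integrable_on_halfline_dominated[OF _ has_integral_integrable[OF w] le])
      (intro continuous_intros cont, auto)
  then show "((\<lambda>t. ?w t *\<^sub>R s t) has_integral laplace_coeff L s n) {0..}"
    unfolding laplace_coeff_def by (rule integrable_integral)
  have "norm (laplace_coeff L s n) \<le> integral {0..} (\<lambda>t. ?w t * c)"
    unfolding laplace_coeff_def
    by (rule integral_norm_bound_integral[OF int has_integral_integrable[OF w]]) (simp only: le atLeast_iff)
  then show "norm (laplace_coeff L s n) \<le> c / L ^ Suc n"
    using integral_unique[OF w] by simp
qed

text \<open>Expand \<open>exp (z * t)\<close> under the integral. For \<open>z, t \<ge> 0\<close> the remainder of the exponential series is
  nonnegative, so the norm of the error is at most \<open>c\<close> times its weighted integral; and that is explicit,
  namely the remainder \<open>q K\<close> of the geometric series for \<open>1 / (L - z)\<close>.\<close>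

lemma laplace_transform_expansion:
  fixes s :: "real \<Rightarrow> 'a::banach"
  assumes cont: "continuous_on {0..} s" and bound: "\<And>t. t \<ge> 0 \<Longrightarrow> norm (s t) \<le> c"
    and z: "0 \<le> z" "z < L"
    and N: "((\<lambda>t. exp (- (L - z) * t) *\<^sub>R s t) has_integral N) {0..}"
  shows "(\<lambda>n. z ^ n *\<^sub>R laplace_coeff L s n) sums N"
proof -
  define p where "p K t = (\<Sum>n<K. z ^ n * (exp (- L * t) * (t ^ n / fact n)))" for K t
  define q where "q K = 1 / (L - z) - (\<Sum>n<K. z ^ n * (1 / L ^ Suc n))" for K
  have L: "L > 0" using z by simp
  have p_le: "p K t \<le> exp (- (L - z) * t)" if "t \<ge> 0" for K t
  proof -
    have "(\<Sum>n<K. (z * t) ^ n /\<^sub>R fact n) \<le> (\<Sum>n. (z * t) ^ n /\<^sub>R fact n)"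
      using z that by (intro sum_le_suminf sums_summable[OF exp_converges]) auto
    also have "\<dots> = exp (z * t)" by (rule sums_unique[OF exp_converges, symmetric])
    finally have "exp (- L * t) * (\<Sum>n<K. (z * t) ^ n /\<^sub>R fact n) \<le> exp (- L * t) * exp (z * t)"
      by (rule mult_left_mono) simp
    also have "exp (- L * t) * exp (z * t) = exp (- (L - z) * t)"
      by (simp add: exp_add[symmetric] algebra_simps)
    also have "exp (- L * t) * (\<Sum>n<K. (z * t) ^ n /\<^sub>R fact n) = p K t"
      unfolding p_def by (simp add: sum_distrib_left power_mult_distrib divide_inverse mult_ac)
    finally show ?thesis .
  qed
  have remainder: "norm (N - (\<Sum>n<K. z ^ n *\<^sub>R laplace_coeff L s n)) \<le> q K * c" for K
  proof -
    have "((\<lambda>t. \<Sum>n<K. z ^ n *\<^sub>R ((exp (- L * t) * (t ^ n / fact n)) *\<^sub>R s t))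
        has_integral (\<Sum>n<K. z ^ n *\<^sub>R laplace_coeff L s n)) {0..}"
      by (intro has_integral_sum has_integral_cmul laplace_coeff_has_integral[OF cont bound L]) auto
    then have "((\<lambda>t. p K t *\<^sub>R s t) has_integral (\<Sum>n<K. z ^ n *\<^sub>R laplace_coeff L s n)) {0..}"
      by (simp add: p_def scaleR_sum_left)
    from has_integral_diff[OF N this]
    have int: "((\<lambda>t. (exp (- (L - z) * t) - p K t) *\<^sub>R s t)
        has_integral (N - (\<Sum>n<K. z ^ n *\<^sub>R laplace_coeff L s n))) {0..}"
      by (simp add: scaleR_diff_left)
    have "(p K has_integral (\<Sum>n<K. z ^ n * (1 / L ^ Suc n))) {0..}"
      unfolding p_def[abs_def]
      by (intro has_integral_sum has_integral_mult_right has_integral_exp_times_power L) auto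
    moreover have "((\<lambda>t. exp (- (L - z) * t)) has_integral 1 / (L - z)) {0..}"
      using has_integral_exp_times_power[of "L - z" 0] z by simp
    ultimately have w: "((\<lambda>t. (exp (- (L - z) * t) - p K t) * c) has_integral q K * c) {0..}"
      unfolding q_def by (intro has_integral_mult_left has_integral_diff)
    have le: "norm ((exp (- (L - z) * t) - p K t) *\<^sub>R s t) \<le> (exp (- (L - z) * t) - p K t) * c"
      if "t \<in> {0..}" for t
      using bound[of t] p_le[of t K] that by (simp add: mult_left_mono)
    show ?thesis
      using integral_norm_bound_integral[OF has_integral_integrable[OF int] has_integral_integrable[OF w] le]
      unfolding integral_unique[OF int] integral_unique[OF w] .
  qed
  have "(\<lambda>n. 1 / L * (z / L) ^ n) sums (1 / L * (1 / (1 - z / L)))"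
    by (intro sums_mult geometric_sums) (use z in auto)
  moreover have "1 / L * (1 / (1 - z / L)) = 1 / (L - z)" using z by (simp add: field_simps)
  ultimately have "(\<lambda>n. z ^ n * (1 / L ^ Suc n)) sums (1 / (L - z))"
    by (simp add: power_divide)
  then have "(\<lambda>K. \<Sum>n<K. z ^ n * (1 / L ^ Suc n)) \<longlonglongrightarrow> 1 / (L - z)"
    by (simp add: sums_def)
  then have "(\<lambda>K. q K * c) \<longlonglongrightarrow> (1 / (L - z) - 1 / (L - z)) * c"
    unfolding q_def by (intro tendsto_intros)
  then have "(\<lambda>K. q K * c) \<longlonglongrightarrow> 0" by simp
  then have "(\<lambda>K. N - (\<Sum>n<K. z ^ n *\<^sub>R laplace_coeff L s n)) \<longlonglongrightarrow> 0"
    by (rule Lim_null_comparison[rotated]) (use remainder in auto)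
  from tendsto_diff[OF tendsto_const[of N] this] show ?thesis by (simp add: sums_def)
qed

lemma power_series_delay:
  fixes v :: "nat \<Rightarrow> 'a::real_normed_vector"
  assumes "(\<lambda>n. z ^ n *\<^sub>R v n) sums s"
  shows "(\<lambda>n. z ^ n *\<^sub>R delay v n) sums (z *\<^sub>R s)"
  using sums_Suc[of "\<lambda>n. z ^ n *\<^sub>R delay v n" "z *\<^sub>R s"] sums_scaleR_right[OF assms, of z] by simp

text \<open>Restriction to real \<open>\<lambda> = l\<close>, where the principal power is the square and the complex exponential acts
  as a real scalar. Real points suffice, since they determine a power series.\<close>

lemma sine_family_resolvent:
  assumes "sine_family D A S"
  obtains \<omega> :: real where "\<omega> \<ge> 0"
    "\<And>l. l > \<omega> \<Longrightarrow> complex_of_real (l\<^sup>2) \<in> resolvent_set D A"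
    "\<And>l x. l > \<omega> \<Longrightarrow>
      ((\<lambda>t. exp (- l * t) *\<^sub>R S t x) has_integral resolvent D A (complex_of_real (l\<^sup>2)) x) {0..}"
proof -
  obtain \<omega> :: real where \<omega>: "\<omega> \<ge> 0" and *: "\<And>\<mu>. Re \<mu> > \<omega> \<Longrightarrow>
       \<mu> powr of_real 2 \<in> resolvent_set D A \<and>
       (\<forall>x. ((\<lambda>t. exp (- \<mu> * of_real t) *\<^sub>C S t x)
               has_integral resolvent D A (\<mu> powr of_real 2) x) {0..})"
    using assms unfolding sine_family_def resolvent_family_def by blast
  have powr: "complex_of_real l powr of_real 2 = of_real (l\<^sup>2)" if "l > \<omega>" for l
    using that \<omega> by (subst powr_of_real) simp_all
  have exp: "exp (- complex_of_real l * complex_of_real t) *\<^sub>C x = exp (- l * t) *\<^sub>R x" for l t and x :: 'a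
    by (simp only: scaleC_of_real[symmetric] exp_of_real[symmetric] of_real_mult of_real_minus)
  show thesis
  proof (rule that[OF \<omega>])
    fix l assume l: "l > \<omega>"
    show "complex_of_real (l\<^sup>2) \<in> resolvent_set D A"
      using *[of "complex_of_real l"] l unfolding powr[OF l] by simp
    show "((\<lambda>t. exp (- l * t) *\<^sub>R S t x) has_integral resolvent D A (complex_of_real (l\<^sup>2)) x) {0..}" for x
      using *[of "complex_of_real l"] l unfolding powr[OF l] exp by simp
  qed
qed

lemma resolvent_identity:
  fixes D :: "'a::complex_banach set"
  assumes "complex_of_real a \<in> resolvent_set D A" "complex_of_real b \<in> resolvent_set D A"
  shows "resolvent D A (of_real b) x
    = resolvent D A (of_real a) (x + (a - b) *\<^sub>R resolvent D A (of_real b) x)"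
proof -
  let ?y = "resolvent D A (of_real b) x"
  have "b *\<^sub>R ?y - A ?y = x" "?y \<in> D"
    using resolvent_props[OF assms(2)] by (simp_all add: scaleC_of_real)
  then have "x + (a - b) *\<^sub>R ?y = of_real a *\<^sub>C ?y - A ?y"
    by (simp add: scaleC_of_real algebra_simps)
  then show ?thesis using resolvent_props(3)[OF assms(1) \<open>?y \<in> D\<close>] by simp
qed

text \<open>Both sides are Taylor coefficients of the resolvent, the left one from the Laplace transform, which
  yields the norm bound, the right one from the resolvent identity, which yields the algebra. The
  choice \<open>L = \<omega> + 1\<close> keeps \<open>L - z\<close> to the right of \<open>\<omega>\<close> for the small \<open>z\<close> at which the two are compared, and
  makes \<open>L \<ge> 1\<close>.\<close>

lemma laplace_coeff_eq_resolvent_coeff: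
  fixes D :: "'a::complex_banach set"
  assumes res: "\<And>l. l > \<omega> \<Longrightarrow> complex_of_real (l\<^sup>2) \<in> resolvent_set D A"
    and lap: "\<And>l. l > \<omega> \<Longrightarrow>
      ((\<lambda>t. exp (- l * t) *\<^sub>R s t) has_integral resolvent D A (complex_of_real (l\<^sup>2)) x) {0..}"
    and cont: "continuous_on {0..} s" and bound: "\<And>t. t \<ge> 0 \<Longrightarrow> norm (s t) \<le> c"
    and \<omega>: "\<omega> \<ge> 0" and L: "L = \<omega> + 1"
  shows "laplace_coeff L s n = resolvent_coeff (resolvent D A (complex_of_real (L\<^sup>2))) L n x"
proof (rule resolvent_coeff_unique)
  define Q where "Q = resolvent D A (complex_of_real (L\<^sup>2))"
  define H where "H = laplace_coeff L s"
  have resL: "complex_of_real (L\<^sup>2) \<in> resolvent_set D A" using res[of L] L by simp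
  show Qc: "bounded_clinear (resolvent D A (complex_of_real (L\<^sup>2)))"
    using resL by (simp add: resolvent_set_def)
  then have Q: "bounded_clinear Q" by (simp add: Q_def)
  then have Qb: "bounded_linear Q" by (simp add: bounded_clinear_def)
  \<comment> \<open>The defect of \<open>H\<close> in the recursion; its power series vanishes by the resolvent identity.\<close>
  define b where "b n = (if n = 0 then Q x else 0) + (2 * L) *\<^sub>R Q (delay H n)
      - Q (delay (delay H) n) - H n" for n
  have c: "c \<ge> 0" using bound[of 0] norm_ge_zero[of "s 0"] by linarith
  have H_le: "norm (H n) \<le> c" for n
  proof -
    have "norm (H n) \<le> c / L ^ Suc n"
      unfolding H_def using L \<omega> by (intro laplace_coeff_has_integral(2)[OF cont bound]) auto
    also have "\<dots> \<le> c"
      using L \<omega> c by (simp add: divide_le_eq mult_le_cancel_left1 one_le_power del: power_Suc)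
    finally show ?thesis .
  qed
  have delay_le: "norm (delay v n) \<le> c" if "\<And>n. norm (v n) \<le> c" for v :: "nat \<Rightarrow> 'a" and n
    using that c by (cases n) auto
  obtain K where K: "K > 0" "\<And>x. norm (Q x) \<le> norm x * K"
    using bounded_linear.pos_bounded[OF Qb] by blast
  have Q_le: "norm (Q y) \<le> c * K" if "norm y \<le> c" for y
    using K(2)[of y] mult_right_mono[OF that, of K] K(1) by linarith
  define B where "B = norm (Q x) + 2 * L * (c * K) + c * K + c"
  have b_le: "norm (b n) \<le> B" for n
  proof -
    have "norm ((2 * L) *\<^sub>R Q (delay H n)) \<le> 2 * L * (c * K)"
      using Q_le[OF delay_le[OF H_le]] L \<omega> by (simp add: mult_left_mono)
    moreover have "norm (Q (delay (delay H) n)) \<le> c * K"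
      by (intro Q_le delay_le H_le)
    moreover have "norm (if n = 0 then Q x else 0) \<le> norm (Q x)" by simp
    ultimately show ?thesis
      unfolding b_def B_def using H_le[of n]
      by (intro norm_triangle_le_diff order_trans[OF norm_triangle_ineq4]
          order_trans[OF norm_triangle_ineq] add_mono | assumption)+
  qed
  have "b n = 0" for n
  proof (rule power_series_coeffs_eq_0[of "1/2"])
    have "summable (\<lambda>n. (1/2::real) ^ n * B)"
      by (intro summable_mult2 summable_geometric) simp
    then show "summable (\<lambda>n. (1/2) ^ n * norm (b n))"
      by (rule summable_comparison_test') (use b_le in \<open>simp add: divide_right_mono\<close>)
  next
    fix z :: real assume z: "0 < z" "z < 1/2"
    define N where "N = resolvent D A (complex_of_real ((L - z)\<^sup>2)) x"
    have l: "L - z > \<omega>" using z L by simp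
    have N: "(\<lambda>n. z ^ n *\<^sub>R H n) sums N"
      unfolding H_def N_def using z L \<omega> lap[OF l]
      by (intro laplace_transform_expansion[OF cont bound]) auto
    have QN: "(\<lambda>n. z ^ n *\<^sub>R Q (v n)) sums Q y" if "(\<lambda>n. z ^ n *\<^sub>R v n) sums y" for v y
      using bounded_linear.sums[OF Qb that] by (simp add: bounded_clinearD[OF Q])
    have x: "(\<lambda>n. z ^ n *\<^sub>R (if n = 0 then Q x else 0)) sums Q x"
      using sums_single[of 0 "\<lambda>n. z ^ n *\<^sub>R Q x"] by (simp add: if_distrib cong: if_cong)
    have "(\<lambda>n. z ^ n *\<^sub>R (if n = 0 then Q x else 0) + (2 * L) *\<^sub>R (z ^ n *\<^sub>R Q (delay H n))
        - z ^ n *\<^sub>R Q (delay (delay H) n) - z ^ n *\<^sub>R H n)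
      sums (Q x + (2 * L) *\<^sub>R Q (z *\<^sub>R N) - Q (z *\<^sub>R z *\<^sub>R N) - N)"
      by (intro sums_add sums_diff sums_scaleR_right x QN power_series_delay N)
    moreover have "Q x + (2 * L) *\<^sub>R Q (z *\<^sub>R N) - Q (z *\<^sub>R z *\<^sub>R N) = N"
    proof -
      have "N = Q (x + (L\<^sup>2 - (L - z)\<^sup>2) *\<^sub>R N)"
        unfolding N_def Q_def by (rule resolvent_identity[OF resL res[OF l]])
      also have "\<dots> = Q x + (L\<^sup>2 - (L - z)\<^sup>2) *\<^sub>R Q N"
        by (simp add: bounded_clinearD[OF Q])
      also have "L\<^sup>2 - (L - z)\<^sup>2 = 2 * L * z - z * z"
        by (simp add: power2_eq_square algebra_simps)
      finally show ?thesis
        by (simp add: bounded_clinearD[OF Q] scaleR_diff_left add_diff_eq[symmetric])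
    qed
    ultimately show "(\<lambda>n. z ^ n *\<^sub>R b n) sums 0"
      by (simp add: b_def scaleR_add_right scaleR_diff_right mult.commute mult.left_commute)
  qed simp
  then show "laplace_coeff L s n = (if n = 0 then resolvent D A (complex_of_real (L\<^sup>2)) x else 0)
      + (2 * L) *\<^sub>R resolvent D A (complex_of_real (L\<^sup>2)) (delay (laplace_coeff L s) n)
      - resolvent D A (complex_of_real (L\<^sup>2)) (delay (delay (laplace_coeff L s)) n)" for n
    unfolding b_def Q_def H_def by (simp add: right_minus_eq)
qed

section \<open>Subordination of discrete resolvent families\<close>

text \<open>The formula for \<open>A (G n x)\<close> is the coefficientwise form of \<open>((L - z)\<^sup>2 - A) F z x = x\<close> for
  \<open>F z = \<Sum>n. z ^ n * G n\<close>. The expansion point lies to the right of \<open>\<omega>\<close>, where the resolvent is known to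
  exist; the passage from there to \<open>(1 - w) powr \<alpha>\<close> is left to the substitution in the next lemma, for
  which the bound on \<open>G n\<close> provides exactly the required radius \<open>L\<close>.\<close>

lemma sine_family_resolvent_taylor:
  fixes D :: "'a::complex_banach set"
  assumes A: "closed_operator D A" and S: "sine_family D A S" and bdd: "bounded_family S"
  obtains L C :: real and G :: "nat \<Rightarrow> 'a \<Rightarrow> 'a" where
    "L \<ge> 1" "C \<ge> 0" "\<And>n. bounded_clinear (G n)"
    "\<And>n x. norm (G n x) \<le> C * norm x / L ^ Suc n"
    "\<And>n x. G n x \<in> D"
    "\<And>n x. A (G n x) = L\<^sup>2 *\<^sub>R G n x - ((if n = 0 then x else 0)
        + (2 * L) *\<^sub>R delay (\<lambda>j. G j x) n - delay (delay (\<lambda>j. G j x)) n)"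
    "\<And>n x. x \<in> D \<Longrightarrow> G n (A x) = A (G n x)"
proof -
  obtain \<omega> :: real where \<omega>: "\<omega> \<ge> 0"
    and res: "\<And>l. l > \<omega> \<Longrightarrow> complex_of_real (l\<^sup>2) \<in> resolvent_set D A"
    and lap: "\<And>l x. l > \<omega> \<Longrightarrow>
      ((\<lambda>t. exp (- l * t) *\<^sub>R S t x) has_integral resolvent D A (complex_of_real (l\<^sup>2)) x) {0..}"
    using sine_family_resolvent[OF S] by blast
  have S_lin: "bounded_linear (S t)" if "t \<ge> 0" for t
    using S that by (auto simp: sine_family_def resolvent_family_def bounded_clinear_def)
  have S_cont: "continuous_on {0..} (\<lambda>t. S t x)" for x
    using S by (auto simp: sine_family_def resolvent_family_def)
  obtain C where C: "\<And>t. t \<ge> 0 \<Longrightarrow> onorm (S t) \<le> C"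
    using bdd unfolding bounded_family_def bdd_above_def by auto
  have C0: "C \<ge> 0" using C[of 0] onorm_pos_le[OF S_lin[of 0]] by simp
  have S_le: "norm (S t x) \<le> C * norm x" if "t \<ge> 0" for t x
    using onorm[OF S_lin[OF that], of x] mult_right_mono[OF C[OF that], of "norm x"] by simp
  define L where "L = \<omega> + 1"
  have L: "L \<ge> 1" "L > \<omega>" using \<omega> by (simp_all add: L_def)
  define Q where "Q = resolvent D A (complex_of_real (L\<^sup>2))"
  define G where "G = resolvent_coeff Q L"
  have resL: "complex_of_real (L\<^sup>2) \<in> resolvent_set D A" using res L by simp
  have Q: "bounded_clinear Q" using resL by (simp add: resolvent_set_def Q_def)
  have Q_in: "Q y \<in> D" for y unfolding Q_def by (rule resolvent_props(1)[OF resL])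
  have Q_A: "A (Q y) = L\<^sup>2 *\<^sub>R Q y - y" for y
    using resolvent_props(2)[OF resL, of y] unfolding Q_def[symmetric] scaleC_of_real
    by (simp add: algebra_simps)
  have Q_commute: "Q (A y) = A (Q y)" if "y \<in> D" for y
  proof -
    have "Q (L\<^sup>2 *\<^sub>R y - A y) = y"
      using resolvent_props(3)[OF resL that] unfolding Q_def[symmetric] scaleC_of_real .
    then show ?thesis unfolding Q_A by (simp add: bounded_clinearD[OF Q] algebra_simps)
  qed
  have G_eq: "G n x = Q ((if n = 0 then x else 0)
        + (2 * L) *\<^sub>R delay (\<lambda>j. G j x) n - delay (delay (\<lambda>j. G j x)) n)" for n x
    unfolding G_def by (rule resolvent_coeff_delay) (simp add: bounded_clinearD[OF Q])
  have G_in: "G n x \<in> D" for n x by (subst G_eq) (rule Q_in)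
  show thesis
  proof (rule that[OF L(1) C0])
    show "bounded_clinear (G n)" for n
      unfolding G_def by (rule bounded_clinear_resolvent_coeff[OF Q])
    show "norm (G n x) \<le> C * norm x / L ^ Suc n" for n x
    proof -
      have "G n x = laplace_coeff L (\<lambda>t. S t x) n"
        unfolding G_def Q_def
        by (rule laplace_coeff_eq_resolvent_coeff[OF res lap S_cont S_le \<omega> L_def, symmetric])
      then show ?thesis
        using laplace_coeff_has_integral(2)[OF S_cont S_le, of L x n] L by simp
    qed
    show "G n x \<in> D" for n x by (rule G_in)
    show "A (G n x) = L\<^sup>2 *\<^sub>R G n x - ((if n = 0 then x else 0)
        + (2 * L) *\<^sub>R delay (\<lambda>j. G j x) n - delay (delay (\<lambda>j. G j x)) n)" for n x
      by (subst (1 2) G_eq) (rule Q_A)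
    show "G n (A x) = A (G n x)" if x: "x \<in> D" for n x
    proof (induction n rule: induct_nat_012)
      case 0
      show ?case using Q_commute[OF x] by (simp add: G_def)
    next
      case 1
      let ?y = "(2 * L) *\<^sub>R Q x"
      have "?y \<in> D" "A ?y = (2 * L) *\<^sub>R Q (A x)"
        using closed_operator_scaleR[OF A Q_in] Q_commute[OF x] by simp_all
      then have "Q ((2 * L) *\<^sub>R Q (A x)) = A (Q ?y)"
        using Q_commute by metis
      then show ?case by (simp add: G_def)
    next
      case (ge2 n)
      let ?y = "(2 * L) *\<^sub>R G (Suc n) x - G n x"
      have "?y \<in> D" "A ?y = (2 * L) *\<^sub>R A (G (Suc n) x) - A (G n x)"
        using closed_operator_diff[OF A] closed_operator_scaleR[OF A] G_in by simp_all
      then have "Q ((2 * L) *\<^sub>R A (G (Suc n) x) - A (G n x)) = A (Q ?y)"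
        using Q_commute by metis
      then show ?case using ge2 by (simp add: G_def)
    qed
  qed
qed

text \<open>Subordination: substitute \<open>e w = L - (1 - w) powr (\<alpha> / 2)\<close> into \<open>\<Sum>j. z ^ j * G j\<close>. The family
  equation follows because \<open>(L - e)\<^sup>2\<close> is the series of \<open>(1 - w) powr \<alpha>\<close>, the inverse of the series with
  coefficients \<open>kseq \<alpha>\<close>, and \<open>A\<close> may be applied termwise since its graph is closed.\<close>

lemma bounded_discrete_resolvent_family_exists:
  fixes D :: "'a::complex_banach set" and G :: "nat \<Rightarrow> 'a \<Rightarrow> 'a"
  assumes A: "closed_operator D A" and L: "L \<ge> 1" and C: "C \<ge> 0"
    and clin: "\<And>n. bounded_clinear (G n)"
    and G_le: "\<And>n x. norm (G n x) \<le> C * norm x / L ^ Suc n"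
    and G_in: "\<And>n x. G n x \<in> D"
    and G_A: "\<And>n x. A (G n x) = L\<^sup>2 *\<^sub>R G n x - ((if n = 0 then x else 0)
        + (2 * L) *\<^sub>R delay (\<lambda>j. G j x) n - delay (delay (\<lambda>j. G j x)) n)"
    and commute: "\<And>n x. x \<in> D \<Longrightarrow> G n (A x) = A (G n x)"
    and \<alpha>: "0 < \<alpha>" "\<alpha> \<le> 2"
  obtains R where "discrete_resolvent_family \<alpha> D A R" "\<And>n x. norm (R n x) \<le> C * norm x"
proof -
  define \<gamma> where "\<gamma> = \<alpha> / 2"
  have \<gamma>: "0 \<le> \<gamma>" "\<gamma> \<le> 1" using \<alpha> by (simp_all add: \<gamma>_def)
  define e where "e = fps_const L - neg_binomial_fps (- \<gamma>)"
  \<comment> \<open>The constant coefficient is \<open>L - 1\<close>, which is where \<open>L \<ge> 1\<close> enters; the others need \<open>\<gamma> \<le> 1\<close>.\<close>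
  have e_nonneg: "0 \<le> e $ n" for n
  proof (cases "n = 0")
    case True
    then show ?thesis using L by (simp add: e_def neg_binomial_fps_def)
  next
    case False
    then show ?thesis using neg_binomial_fps_minus_nonpos[OF \<gamma>, of n] by (simp add: e_def)
  qed
  have L_e: "fps_const L - e = neg_binomial_fps (- \<gamma>)" by (simp add: e_def)
  have inv: "(fps_const L - e) * neg_binomial_fps \<gamma> = 1"
    unfolding L_e neg_binomial_fps_mult by (simp add: neg_binomial_fps_0)
  have L0: "L > 0" using L by simp
  note geom = fps_geometric_bound[OF L0 e_nonneg neg_binomial_fps_nonneg[OF \<gamma>(1)] inv]
  define R where "R n x = (\<Sum>j. ((e ^ j) $ n) *\<^sub>R G j x)" for n x
  have term_le: "norm (((e ^ j) $ n) *\<^sub>R G j x) \<le> (e ^ j) $ n / L ^ Suc j * (C * norm x)" for j n x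
    using mult_left_mono[OF G_le[of j x] fps_power_nonneg[OF e_nonneg, of j n]]
      fps_power_nonneg[OF e_nonneg, of j n] by simp
  have abs: "summable (\<lambda>j. norm (((e ^ j) $ n) *\<^sub>R G j x))" for n x
    by (rule summable_comparison_test'[OF summable_mult2[OF geom(1), where c = "C * norm x"]])
      (use term_le in simp)
  have sums: "(\<lambda>j. ((e ^ j) $ n) *\<^sub>R G j x) sums R n x" for n x
    unfolding R_def by (rule summable_sums[OF summable_norm_cancel[OF abs]])
  have R_le: "norm (R n x) \<le> C * norm x" for n x
  proof -
    have "norm (R n x) \<le> (\<Sum>j. norm (((e ^ j) $ n) *\<^sub>R G j x))"
      unfolding R_def by (rule summable_norm[OF abs])
    also have "\<dots> \<le> (\<Sum>j. (e ^ j) $ n / L ^ Suc j * (C * norm x))"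
      by (rule suminf_le[OF term_le abs summable_mult2[OF geom(1)]])
    also have "\<dots> = (\<Sum>j. (e ^ j) $ n / L ^ Suc j) * (C * norm x)"
      by (rule suminf_mult2[OF geom(1), symmetric])
    also have "\<dots> \<le> 1 * (C * norm x)"
      using C by (intro mult_right_mono order_trans[OF geom(2) neg_binomial_fps_le_1[OF \<gamma>]]) auto
    finally show ?thesis by simp
  qed
  have R_clin: "bounded_clinear (R n)" for n
    unfolding bounded_clinear_def
  proof (intro conjI allI bounded_linear_intro[of _ C])
    show "R n (x + y) = R n x + R n y" for x y
    proof (rule sums_unique2[OF sums])
      show "(\<lambda>j. ((e ^ j) $ n) *\<^sub>R G j (x + y)) sums (R n x + R n y)"
        unfolding bounded_clinearD(1)[OF clin] scaleR_add_right by (intro sums_add sums)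
    qed
    show "R n (r *\<^sub>R x) = r *\<^sub>R R n x" for r x
    proof (rule sums_unique2[OF sums])
      show "(\<lambda>j. ((e ^ j) $ n) *\<^sub>R G j (r *\<^sub>R x)) sums (r *\<^sub>R R n x)"
        unfolding bounded_clinearD(3)[OF clin] scaleR_left_commute[of _ r]
        by (intro sums_scaleR_right sums)
    qed
    show "norm (R n x) \<le> norm x * C" for x using R_le[of n x] by (simp add: mult.commute)
    show "R n (c *\<^sub>C x) = c *\<^sub>C R n x" for c x
    proof (rule sums_unique2[OF sums])
      show "(\<lambda>j. ((e ^ j) $ n) *\<^sub>R G j (c *\<^sub>C x)) sums (c *\<^sub>C R n x)"
        unfolding bounded_clinearD(4)[OF clin] scaleC_scaleR_commute[symmetric]
        by (rule bounded_linear.sums[OF bounded_linear_scaleC sums])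
    qed
  qed
  have R_comm: "R n x \<in> D \<and> R n (A x) = A (R n x)" if x: "x \<in> D" for n x
  proof -
    have "(\<lambda>j. A (((e ^ j) $ n) *\<^sub>R G j x)) sums R n (A x)"
      using sums[of n "A x"] by (simp add: closed_operator_scaleR[OF A G_in] commute[OF x])
    then show ?thesis
      using closed_operator_sums[OF A closed_operator_scaleR(1)[OF A G_in] sums[of n x]] by auto
  qed
  have R_res: "conv (kseq \<alpha>) (\<lambda>j. R j x) n \<in> D \<and>
      R n x = kseq \<alpha> n *\<^sub>R x + A (conv (kseq \<alpha>) (\<lambda>j. R j x) n)" for n x
  proof -
    define k where "k = neg_binomial_fps \<alpha>"
    have kseq: "kseq \<alpha> = fps_nth k"
      using \<alpha> by (auto simp: k_def kseq_eq_neg_binomial_fps)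
    have k_inv: "(fps_const L - e) * (fps_const L - e) * k = 1"
      unfolding L_e k_def neg_binomial_fps_mult by (simp add: \<gamma>_def neg_binomial_fps_0)
    \<comment> \<open>\<open>P a\<close> is the \<open>n\<close>-th coefficient of \<open>a\<close> times the generating function of \<open>R\<close>; the formula for
    \<open>A (G j x)\<close> expresses \<open>A (P k)\<close> through \<open>P k\<close>, \<open>P (k * e)\<close> and \<open>P (k * e * e)\<close>.\<close>
    define P where "P a = conv (fps_nth a) (\<lambda>j. R j x) n" for a
    have P: "(\<lambda>j. ((a * e ^ j) $ n) *\<^sub>R G j x) sums P a" for a
      unfolding P_def by (rule conv_fps_sums[OF sums])
    have P1: "(\<lambda>j. ((k * e ^ j) $ n) *\<^sub>R delay (\<lambda>j. G j x) j) sums P (k * e)"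
      by (rule sums_delay[OF P])
    have P2: "(\<lambda>j. ((k * e ^ j) $ n) *\<^sub>R delay (delay (\<lambda>j. G j x)) j) sums P (k * e * e)"
      by (intro sums_delay P)
    have P0: "(\<lambda>j. ((k * e ^ j) $ n) *\<^sub>R (if j = 0 then x else 0)) sums ((k $ n) *\<^sub>R x)"
      using sums_single[of 0 "\<lambda>j. ((k * e ^ j) $ n) *\<^sub>R x"] by (simp add: if_distrib cong: if_cong)
    have "(\<lambda>j. L\<^sup>2 *\<^sub>R (((k * e ^ j) $ n) *\<^sub>R G j x)
        - (((k * e ^ j) $ n) *\<^sub>R (if j = 0 then x else 0)
          + (2 * L) *\<^sub>R (((k * e ^ j) $ n) *\<^sub>R delay (\<lambda>j. G j x) j)
          - ((k * e ^ j) $ n) *\<^sub>R delay (delay (\<lambda>j. G j x)) j))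
      sums (L\<^sup>2 *\<^sub>R P k - ((k $ n) *\<^sub>R x + (2 * L) *\<^sub>R P (k * e) - P (k * e * e)))"
      by (intro sums_add sums_diff sums_scaleR_right P P0 P1 P2)
    then have "(\<lambda>j. A (((k * e ^ j) $ n) *\<^sub>R G j x))
      sums (L\<^sup>2 *\<^sub>R P k - ((k $ n) *\<^sub>R x + (2 * L) *\<^sub>R P (k * e) - P (k * e * e)))"
      unfolding closed_operator_scaleR(2)[OF A G_in] G_A
      by (simp only: scaleR_add_right scaleR_diff_right scaleR_left_commute)
    from closed_operator_sums[OF A closed_operator_scaleR(1)[OF A G_in] P[of k] this]
    have AP: "P k \<in> D"
      "A (P k) = L\<^sup>2 *\<^sub>R P k - ((k $ n) *\<^sub>R x + (2 * L) *\<^sub>R P (k * e) - P (k * e * e))" .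
    have R_eq: "L\<^sup>2 *\<^sub>R P k - (2 * L) *\<^sub>R P (k * e) + P (k * e * e) = R n x"
    proof (rule sums_unique2[OF _ sums])
      have expand: "l * l * (k * p) - (l + l) * (k * e * p) + k * e * e * p
          = (l - e) * (l - e) * k * p" for l p :: "real fps"
        by (simp add: algebra_simps)
      have coeff: "(e ^ j) $ n
          = L\<^sup>2 * (k * e ^ j) $ n - 2 * L * (k * e * e ^ j) $ n + (k * e * e * e ^ j) $ n" for j
      proof -
        have "fps_const (L\<^sup>2) * (k * e ^ j) - fps_const (2 * L) * (k * e * e ^ j) + k * e * e * e ^ j
            = e ^ j"
          using expand[of "fps_const L" "e ^ j"] unfolding k_inv fps_const_mult fps_const_add
          by (simp add: power2_eq_square)
        then have "(fps_const (L\<^sup>2) * (k * e ^ j) - fps_const (2 * L) * (k * e * e ^ j)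
            + k * e * e * e ^ j) $ n = (e ^ j) $ n" by simp
        then show ?thesis by (simp only: fps_add_nth fps_sub_nth fps_mult_left_const_nth)
      qed
      have "(\<lambda>j. L\<^sup>2 *\<^sub>R (((k * e ^ j) $ n) *\<^sub>R G j x) - (2 * L) *\<^sub>R (((k * e * e ^ j) $ n) *\<^sub>R G j x)
          + ((k * e * e * e ^ j) $ n) *\<^sub>R G j x)
        sums (L\<^sup>2 *\<^sub>R P k - (2 * L) *\<^sub>R P (k * e) + P (k * e * e))"
        by (intro sums_add sums_diff sums_scaleR_right P)
      then show "(\<lambda>j. ((e ^ j) $ n) *\<^sub>R G j x)
          sums (L\<^sup>2 *\<^sub>R P k - (2 * L) *\<^sub>R P (k * e) + P (k * e * e))"
        unfolding coeff scaleR_add_left scaleR_diff_left scaleR_scaleR .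
    qed
    have rearrange: "y = b + (a - (b + c - d))" if "a - c + d = y" for a b c d y :: 'a
      using that by auto
    show ?thesis
      unfolding kseq P_def[symmetric] AP(2) by (intro conjI AP(1) rearrange[OF R_eq])
  qed
  show thesis
  proof (rule that[OF _ R_le])
    show "discrete_resolvent_family \<alpha> D A R"
      unfolding discrete_resolvent_family_def using R_clin R_comm R_res by blast
  qed
qed

section \<open>The Volterra recursion in weighted spaces\<close>

text \<open>For \<open>n < 2\<close> the index set is empty, which encodes \<open>u 0 = u 1 = 0\<close>.\<close>

fun volterra_solution :: "(nat \<Rightarrow> 'a \<Rightarrow> 'a) \<Rightarrow> (nat \<Rightarrow> 'a \<Rightarrow> 'a) \<Rightarrow> nat \<Rightarrow> 'a::comm_monoid_add" where
  "volterra_solution R f n = (\<Sum>k<n-1. R (n - 2 - k) (f k (volterra_solution R f k)))"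

declare volterra_solution.simps [simp del]

text \<open>The family that a solution refers to can only be \<open>R\<close>, because \<open>A\<close> generates at most one; after that,
  the defining formula is a course-of-values recursion.\<close>

lemma is_solution_iff_volterra_solution:
  assumes A: "closed_operator D A" and \<alpha>: "\<alpha> > 0" and R: "discrete_resolvent_family \<alpha> D A R"
  shows "is_solution \<alpha> D A f u \<longleftrightarrow> u = volterra_solution R f"
proof -
  have idx: "{0..n - 2} = {..<n - 1}" if "n \<ge> 2" for n :: nat using that by auto
  have "is_solution \<alpha> D A f u \<longleftrightarrow> (u 0 = 0 \<and> u 1 = 0 \<and>
      (\<forall>n\<ge>2. u n = (\<Sum>k=0..n-2. R (n - 2 - k) (f k (u k)))))"
    using discrete_resolvent_family_unique[OF A \<alpha> R] R unfolding is_solution_def by blast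
  also have "\<dots> \<longleftrightarrow> (\<forall>n. u n = (\<Sum>k<n-1. R (n - 2 - k) (f k (u k))))" (is "?l \<longleftrightarrow> ?r")
  proof
    assume l: ?l
    show ?r
    proof
      fix n :: nat
      consider "n = 0" | "n = 1" | "n \<ge> 2" by linarith
      then show "u n = (\<Sum>k<n-1. R (n - 2 - k) (f k (u k)))"
        using l by cases (simp_all add: idx)
    qed
  next
    assume r: ?r
    have "u 0 = 0" "u 1 = 0" using r[rule_format, of 0] r[rule_format, of 1] by simp_all
    then show ?l using r idx by metis
  qed
  also have "\<dots> \<longleftrightarrow> u = volterra_solution R f"
  proof
    assume r: "\<forall>n. u n = (\<Sum>k<n-1. R (n - 2 - k) (f k (u k)))"
    have "u n = volterra_solution R f n" for n
    proof (induction n rule: less_induct)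
      case (less n)
      have "(\<Sum>k<n-1. R (n - 2 - k) (f k (u k)))
          = (\<Sum>k<n-1. R (n - 2 - k) (f k (volterra_solution R f k)))"
        by (rule sum.cong) (simp_all add: less)
      then show ?case using r by (metis volterra_solution.simps)
    qed
    then show "u = volterra_solution R f" by blast
  next
    assume u: "u = volterra_solution R f"
    show "\<forall>n. u n = (\<Sum>k<n-1. R (n - 2 - k) (f k (u k)))"
      unfolding u by (intro allI volterra_solution.simps)
  qed
  finally show ?thesis .
qed

text \<open>From some \<open>N\<close> on, \<open>K * (\<Sum>k<n-1. h k) \<le> h n\<close>, so a bound \<open>norm (u k) \<le> B * h k\<close> for all \<open>k < n\<close>
  reproduces itself at \<open>n\<close> with the same \<open>B\<close>; the finitely many indices below \<open>N\<close> determine \<open>B\<close>.\<close>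

lemma admissible_weight_gronwall:
  fixes u :: "nat \<Rightarrow> 'a::real_normed_vector"
  assumes h: "admissible_weight h"
    and u: "\<And>n. norm (u n) \<le> K * (\<Sum>k<n-1. norm (u k))" and K: "K \<ge> 0"
  shows "u \<in> linf_weighted h"
proof -
  have h_pos: "h n > 0" for n using h by (simp add: admissible_weight_def)
  have "(\<lambda>n. (1 / h n) * (\<Sum>k<n-1. h k)) \<longlonglongrightarrow> 0"
    using h by (simp add: admissible_weight_def)
  then have "(\<lambda>n. K * ((1 / h n) * (\<Sum>k<n-1. h k))) \<longlonglongrightarrow> K * 0"
    by (rule tendsto_mult_left)
  then have "\<forall>\<^sub>F n in sequentially. K * ((1 / h n) * (\<Sum>k<n-1. h k)) < 1"
    by (rule order_tendstoD(2)) simp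
  then obtain N where N': "\<And>n. n \<ge> N \<Longrightarrow> K * ((1 / h n) * (\<Sum>k<n-1. h k)) < 1"
    by (auto simp: eventually_sequentially)
  have N: "K * (\<Sum>k<n-1. h k) \<le> h n" if "n \<ge> N" for n
    using h_pos[of n] N'[OF that] by (simp add: field_simps)
  define B where "B = (\<Sum>n<N. norm (u n) / h n)"
  have ratio: "norm (u n) / h n \<ge> 0" for n using h_pos[of n] by simp
  have B: "B \<ge> 0" unfolding B_def by (intro sum_nonneg ratio)
  have bound: "norm (u n) \<le> B * h n" for n
  proof (induction n rule: less_induct)
    case (less n)
    show ?case
    proof (cases "n < N")
      case True
      have "norm (u n) / h n \<le> B"
        unfolding B_def using True by (intro member_le_sum ratio) auto
      then show ?thesis using h_pos[of n] by (simp add: divide_le_eq)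
    next
      case False
      have "norm (u n) \<le> K * (\<Sum>k<n-1. norm (u k))" by (rule u)
      also have "\<dots> \<le> K * (\<Sum>k<n-1. B * h k)"
        using K less by (intro mult_left_mono sum_mono) auto
      also have "\<dots> = B * (K * (\<Sum>k<n-1. h k))" by (simp add: sum_distrib_left mult_ac)
      also have "\<dots> \<le> B * h n" using False B by (intro mult_left_mono N) auto
      finally show ?thesis .
    qed
  qed
  have "norm (u n) / h n \<le> B" for n
    using bound[of n] h_pos[of n] by (simp add: divide_le_eq)
  then show ?thesis unfolding linf_weighted_def by (auto intro!: bdd_aboveI2)
qed

theorem theorem6p7:
  fixes D :: "'a::complex_banach set" and A :: "'a \<Rightarrow> 'a"
    and S :: "real \<Rightarrow> 'a \<Rightarrow> 'a"
    and h :: "nat \<Rightarrow> real" and f :: "nat \<Rightarrow> 'a \<Rightarrow> 'a"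
    and M :: "nat \<Rightarrow> real" and W :: "real \<Rightarrow> real" and C :: real
    and \<mu> :: complex and \<alpha> :: real
  assumes "closed_operator D A"
    and "sine_family D A S" and "bounded_family S"
    and "\<mu> \<in> resolvent_set D A" and "compact_operator (resolvent D A \<mu>)"
    and "admissible_weight h"
    and "bounded (range M)"
    and "\<forall>y\<ge>0. 0 \<le> W y \<and> W y \<le> C * y"
    and "\<forall>k x. norm (f k x) \<le> M k * W (norm x)"
    and "continuous_weighted h (nemytskii f)"
    and "1 < \<alpha>" and "\<alpha> \<le> 2"
  shows "\<exists>!u. u \<in> linf_weighted h \<and> is_solution \<alpha> D A f u"
proof -
  obtain L B :: real and G :: "nat \<Rightarrow> 'a \<Rightarrow> 'a" where G:
    "L \<ge> 1" "B \<ge> 0" "\<And>n. bounded_clinear (G n)"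
    "\<And>n x. norm (G n x) \<le> B * norm x / L ^ Suc n"
    "\<And>n x. G n x \<in> D"
    "\<And>n x. A (G n x) = L\<^sup>2 *\<^sub>R G n x - ((if n = 0 then x else 0)
        + (2 * L) *\<^sub>R delay (\<lambda>j. G j x) n - delay (delay (\<lambda>j. G j x)) n)"
    "\<And>n x. x \<in> D \<Longrightarrow> G n (A x) = A (G n x)"
    using sine_family_resolvent_taylor[OF assms(1-3)] by metis
  have \<alpha>: "\<alpha> > 0" using assms(11) by simp
  obtain R where R: "discrete_resolvent_family \<alpha> D A R"
    and R_le: "\<And>n x. norm (R n x) \<le> B * norm x"
    using bounded_discrete_resolvent_family_exists[OF assms(1) G \<alpha> assms(12)] by blast
  obtain m where m: "\<And>k. \<bar>M k\<bar> \<le> m"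
    using assms(7) by (auto simp: bounded_iff)
  have m0: "m \<ge> 0" using m[of 0] by linarith
  have C0: "C \<ge> 0" using assms(8)[rule_format, of 1] by simp
  have f_le: "norm (f k x) \<le> m * C * norm x" for k x
  proof -
    have W: "0 \<le> W (norm x)" "W (norm x) \<le> C * norm x" using assms(8) by simp_all
    have "norm (f k x) \<le> M k * W (norm x)" using assms(9) by blast
    also have "\<dots> \<le> m * W (norm x)" using m[of k] W by (intro mult_right_mono) auto
    also have "\<dots> \<le> m * (C * norm x)" using W m0 by (intro mult_left_mono) auto
    finally show ?thesis by simp
  qed
  let ?u = "volterra_solution R f"
  have "?u \<in> linf_weighted h"
  proof (rule admissible_weight_gronwall[OF assms(6)])
    show "0 \<le> B * (m * C)" using G(2) m0 C0 by simp
    show "norm (?u n) \<le> B * (m * C) * (\<Sum>k<n-1. norm (?u k))" for n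
    proof -
      have "norm (?u n) = norm (\<Sum>k<n-1. R (n - 2 - k) (f k (?u k)))"
        by (subst volterra_solution.simps) simp
      also have "\<dots> \<le> (\<Sum>k<n-1. B * (m * C) * norm (?u k))"
      proof (rule sum_norm_le)
        show "norm (R (n - 2 - k) (f k (?u k))) \<le> B * (m * C) * norm (?u k)" for k
          using order_trans[OF R_le mult_left_mono[OF f_le G(2)]] by (simp add: mult.assoc)
      qed
      finally show ?thesis by (simp add: sum_distrib_left)
    qed
  qed
  then show ?thesis
    unfolding is_solution_iff_volterra_solution[OF assms(1) \<alpha> R] by blast
qed

end
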